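(* Let $d\ge1$, $N\ge1$ and $I_1,\dots,I_d\ge1$ be integers, $L=I_1I_2\cdots I_d$, and let $\mathcal{X}_{\cdot,1},\dots,\mathcal{X}_{\cdot,N}$ be tensors in $\mathbb{R}^{I_1\times\cdots\times I_d}$ with entries $\mathcal{X}(i_1,\dots,i_d,n)$. For each mode $k=1,\dots,d$ define the $I_k\times I_k$ matrix $$A^k(i_k,j_k)=\sum_{n=1}^{N}\ \sum_{i_1,\dots,i_{k-1},i_{k+1},\dots,i_d}\mathcal{X}(i_1,\dots,i_k,\dots,i_d,n)\,\mathcal{X}(i_1,\dots,j_k,\dots,i_d,n).$$ Then each $A^k$ is symmetric, so there is an orthogonal matrix $U^k$ with $A^kU^k=U^k\Sigma^k$, $\Sigma^k$ diagonal. For any such choice of $U^1,\dots,U^d$, set $\mathcal{U}_{\mathbf{i},\mathbf{j}}=U^1_{i_1,j_1}U^2_{i_2,j_2}\cdots U^d_{i_d,j_d}$ and $\hat{\mathcal{U}}_{\mathbf{i},m}=\mathcal{U}_{\mathbf{i},\mathbf{j}(m)}$ for $m=1,\dots,L$, where $m\mapsto\mathbf{j}(m)$ is the inverse of the vector-to-linear index bijection. Then the tensors $\hat{\mathcal{U}}_{\cdot,1},\dots,\hat{\mathcal{U}}_{\cdot,L}$ are rank-1 and form an orthonormal basis of $\mathbb{R}^{I_1\times\cdots\times I_d}$, and, with $d_{n,m}=\sum_{\mathbf{i}}\mathcal{X}_{\mathbf{i},n}\hat{\mathcal{U}}_{\mathbf{i},m}$, $$\mathcal{X}_{\mathbf{i},n}=\sum_{m=1}^{L}\hat{\mathcal{U}}_{\mathbf{i},m}\,d_{n,m},\qquad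 n=1,\dots,N.$$ Moreover, if $D=(d_{n,m})$ has rank $r$ and singular value decomposition $d_{n,m}=\sum_{l=1}^{r}\sigma_l Y_{n,l}Z_{m,l}$, then $$\mathcal{X}_{\mathbf{i},n}=\sum_{m=1}^{L}\sum_{l=1}^{r}\hat{\mathcal{U}}_{\mathbf{i},m}\,\sigma_l\,Y_{n,l}\,Z_{m,l},\qquad n=1,\dots,N.$$
   Context: An order-$d$ tensor in $\mathbb{R}^{I_1\times\cdots\times I_d}$ is a real array with entries indexed by multi-indices $\mathbf{i}=(i_1,\dots,i_d)$, $1\le i_k\le I_k$; $\mathcal{X}_{\mathbf{i},n}=\mathcal{X}(i_1,\dots,i_d,n)$ is the $\mathbf{i}$ entry of the $n$-th tensor. The inner product is $\langle\mathcal{X},\mathcal{Y}\rangle=\sum_{\mathbf{i}}\mathcal{X}_{\mathbf{i}}\mathcal{Y}_{\mathbf{i}}$. A tensor is rank-1 if it is a nonzero outer product of $d$ vectors, $\mathcal{T}_{\mathbf{i}}=v^1_{i_1}\cdots v^d_{i_d}$. The vector-to-linear index bijection is $\alpha(\mathbf{j})=j_1+(j_2-1)I_1+\cdots+(j_d-1)I_1\cdots I_{d-1}$, from multi-indices onto $\{1,\dots,L\}$, and $\mathbf{j}(m)=\alpha^{-1}(m)$. *)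

theory Defs
  imports
    "HOL-Library.FuncSet"
    "HOL-Library.Function_Algebras"
    "Jordan_Normal_Form.DL_Rank"
begin

text \<open>
  All indices are counted from 0, as in \<^theory>\<open>Jordan_Normal_Form.Matrix\<close>: the modes are
  \<open>0, \<dots>, d - 1\<close>, mode \<open>k\<close> has the indices \<open>0, \<dots>, I k - 1\<close>, and linear indices are
  \<open>0, \<dots>, L - 1\<close>. A multi-index is an extensional function on the set of modes; a tensor is a
  function on multi-indices that vanishes outside the index box, so that tensors of a given
  shape form a subspace of a function space.
\<close>

definition multi_indices :: "nat \<Rightarrow> (nat \<Rightarrow> nat) \<Rightarrow> (nat \<Rightarrow> nat) set" where
  "multi_indices d I = (\<Pi>\<^sub>E k\<in>{..<d}. {..<I k})"

type_synonym tensor = "(nat \<Rightarrow> nat) \<Rightarrow> real"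

definition tensor_space :: "nat \<Rightarrow> (nat \<Rightarrow> nat) \<Rightarrow> tensor set" where
  "tensor_space d I = {T. \<forall>i. i \<notin> multi_indices d I \<longrightarrow> T i = 0}"

definition tensor_inner :: "nat \<Rightarrow> (nat \<Rightarrow> nat) \<Rightarrow> tensor \<Rightarrow> tensor \<Rightarrow> real" where
  "tensor_inner d I S T = (\<Sum>i\<in>multi_indices d I. S i * T i)"

definition tensor_scale :: "real \<Rightarrow> tensor \<Rightarrow> tensor" where
  "tensor_scale c T = (\<lambda>i. c * T i)"

interpretation tensor: vector_space tensor_scale
  by unfold_locales (auto simp: tensor_scale_def fun_eq_iff algebra_simps)

lemma subspace_tensor_space: "tensor.subspace (tensor_space d I)"
  by (auto simp: tensor.subspace_def tensor_space_def tensor_scale_def)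

definition is_rank1 :: "nat \<Rightarrow> (nat \<Rightarrow> nat) \<Rightarrow> tensor \<Rightarrow> bool" where
  "is_rank1 d I T \<longleftrightarrow> T \<in> tensor_space d I \<and> T \<noteq> 0 \<and>
     (\<exists>v. (\<forall>k<d. v k \<in> carrier_vec (I k)) \<and>
          (\<forall>i\<in>multi_indices d I. T i = (\<Prod>k<d. v k $ i k)))"

text \<open>
  An orthonormal basis as a family indexed by \<open>{..<L}\<close>; orthonormality makes the family injective,
  so nothing is lost by passing to its image in the last two conjuncts.
\<close>

definition is_orthonormal_basis ::
    "nat \<Rightarrow> (nat \<Rightarrow> nat) \<Rightarrow> nat \<Rightarrow> (nat \<Rightarrow> tensor) \<Rightarrow> bool" where
  "is_orthonormal_basis d I L B \<longleftrightarrow>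
     (\<forall>m<L. B m \<in> tensor_space d I) \<and>
     (\<forall>m<L. \<forall>m'<L. tensor_inner d I (B m) (B m') = (if m = m' then 1 else 0)) \<and>
     tensor.independent (B ` {..<L}) \<and>
     tensor.span (B ` {..<L}) = tensor_space d I"

text \<open>
  The vector-to-linear index map. Counted from 1, it is
  \<open>1 + (\<Sum>k. (j\<^sub>k - 1) * I\<^sub>1 * \<dots> * I\<^bsub>k-1\<^esub>)\<close>.
\<close>

definition lin_index :: "nat \<Rightarrow> (nat \<Rightarrow> nat) \<Rightarrow> (nat \<Rightarrow> nat) \<Rightarrow> nat" where
  "lin_index d I j = (\<Sum>k<d. j k * (\<Prod>l<k. I l))"

definition multi_index_of :: "nat \<Rightarrow> (nat \<Rightarrow> nat) \<Rightarrow> nat \<Rightarrow> (nat \<Rightarrow> nat)" where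
  "multi_index_of d I = the_inv_into (multi_indices d I) (lin_index d I)"

lemma lin_index_less:
  assumes "\<And>k. k < d \<Longrightarrow> j k < I k"
  shows "lin_index d I j < (\<Prod>k<d. I k)"
  using assms
proof (induction d)
  case 0
  then show ?case by (simp add: lin_index_def)
next
  case (Suc d)
  let ?P = "\<Prod>k<d. I k"
  have "lin_index (Suc d) I j < ?P + j d * ?P"
    using Suc by (simp add: lin_index_def)
  also have "\<dots> = Suc (j d) * ?P" by simp
  also have "\<dots> \<le> I d * ?P" using Suc.prems[of d] by (intro mult_right_mono) auto
  finally show ?case by (simp add: mult.commute)
qed

lemma lin_index_eqD:
  assumes "\<And>k. k < d \<Longrightarrow> i k < I k" "\<And>k. k < d \<Longrightarrow> j k < I k"
    and "lin_index d I i = lin_index d I j"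
  shows "\<forall>k<d. i k = j k"
  using assms
proof (induction d)
  case (Suc d)
  let ?P = "\<Prod>k<d. I k"
  have li: "lin_index d I i < ?P" and lj: "lin_index d I j < ?P"
    using Suc.prems by (auto intro!: lin_index_less)
  have eq: "lin_index d I i + i d * ?P = lin_index d I j + j d * ?P"
    using Suc.prems(3) by (simp add: lin_index_def)
  have "(lin_index d I i + i d * ?P) mod ?P = (lin_index d I j + j d * ?P) mod ?P"
    by (simp only: eq)
  with li lj have e: "lin_index d I i = lin_index d I j" by simp
  have "0 < ?P" using li by linarith
  with eq e have "i d = j d" by (metis add_left_cancel mult_right_cancel less_numeral_extra(3))
  moreover have "\<forall>k<d. i k = j k" using Suc e by auto
  ultimately show ?case by (auto simp: less_Suc_eq)
qed simp

lemma bij_betw_lin_index: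
  "bij_betw (lin_index d I) (multi_indices d I) {..<\<Prod>k<d. I k}"
proof -
  have inj: "inj_on (lin_index d I) (multi_indices d I)"
  proof (rule inj_onI)
    fix i j
    assume i: "i \<in> multi_indices d I" and j: "j \<in> multi_indices d I"
      and eq: "lin_index d I i = lin_index d I j"
    have "\<forall>k<d. i k = j k"
      using i j eq by (intro lin_index_eqD) (auto simp: multi_indices_def PiE_iff)
    with i j show "i = j"
      unfolding multi_indices_def by (intro PiE_ext[of i _ _ j]) auto
  qed
  have sub: "lin_index d I ` multi_indices d I \<subseteq> {..<\<Prod>k<d. I k}"
    by (auto simp: multi_indices_def PiE_iff intro!: lin_index_less)
  have "card (lin_index d I ` multi_indices d I) = (\<Prod>k<d. I k)"
    by (simp add: card_image[OF inj], simp add: multi_indices_def card_PiE)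
  with sub have "lin_index d I ` multi_indices d I = {..<\<Prod>k<d. I k}"
    by (intro card_subset_eq) auto
  with inj show ?thesis by (simp add: bij_betw_def)
qed

definition mode_gram :: "nat \<Rightarrow> (nat \<Rightarrow> nat) \<Rightarrow> nat \<Rightarrow> (nat \<Rightarrow> tensor) \<Rightarrow> nat \<Rightarrow> real mat" where
  "mode_gram d I N X k = mat (I k) (I k) (\<lambda>(a, b).
     \<Sum>n<N. \<Sum>i\<in>(\<Pi>\<^sub>E l\<in>{..<d} - {k}. {..<I l}). X n (i(k := a)) * X n (i(k := b)))"

text \<open>
  \<^const>\<open>orthogonal_mat\<close> only asks for pairwise orthogonal nonzero columns, hence the following.
\<close>

definition orthonormal_cols :: "real mat \<Rightarrow> bool" where
  "orthonormal_cols U \<longleftrightarrow> U\<^sup>T * U = 1\<^sub>m (dim_col U)"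

definition is_orthogonal :: "nat \<Rightarrow> real mat \<Rightarrow> bool" where
  "is_orthogonal n U \<longleftrightarrow> U \<in> carrier_mat n n \<and> U\<^sup>T * U = 1\<^sub>m n \<and> U * U\<^sup>T = 1\<^sub>m n"

definition is_eigen_decomp :: "nat \<Rightarrow> real mat \<Rightarrow> real mat \<Rightarrow> real mat \<Rightarrow> bool" where
  "is_eigen_decomp n A U S \<longleftrightarrow> is_orthogonal n U \<and>
     S \<in> carrier_mat n n \<and> diagonal_mat S \<and> A * U = U * S"

definition basis_tensor ::
    "nat \<Rightarrow> (nat \<Rightarrow> nat) \<Rightarrow> (nat \<Rightarrow> real mat) \<Rightarrow> (nat \<Rightarrow> nat) \<Rightarrow> tensor" where
  "basis_tensor d I U j =
     (\<lambda>i. if i \<in> multi_indices d I then \<Prod>k<d. U k $$ (i k, j k) else 0)"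

definition lin_basis_tensor ::
    "nat \<Rightarrow> (nat \<Rightarrow> nat) \<Rightarrow> (nat \<Rightarrow> real mat) \<Rightarrow> nat \<Rightarrow> tensor" where
  "lin_basis_tensor d I U m = basis_tensor d I U (multi_index_of d I m)"

definition coeff_mat ::
    "nat \<Rightarrow> (nat \<Rightarrow> nat) \<Rightarrow> nat \<Rightarrow> nat \<Rightarrow> (nat \<Rightarrow> tensor) \<Rightarrow> (nat \<Rightarrow> real mat) \<Rightarrow> real mat" where
  "coeff_mat d I N L X U =
     mat N L (\<lambda>(n, m). tensor_inner d I (X n) (lin_basis_tensor d I U m))"

text \<open>
  Reduced singular value decomposition with exactly \<open>rank D\<close> positive singular values. They are
  not required to be sorted.
\<close>

definition is_reduced_svd ::
    "nat \<Rightarrow> nat \<Rightarrow> real mat \<Rightarrow> nat \<Rightarrow> (nat \<Rightarrow> real) \<Rightarrow> real mat \<Rightarrow> real mat \<Rightarrow> bool" where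
  "is_reduced_svd N L D r \<sigma> Y Z \<longleftrightarrow>
     r = vec_space.rank N D \<and>
     Y \<in> carrier_mat N r \<and> orthonormal_cols Y \<and>
     Z \<in> carrier_mat L r \<and> orthonormal_cols Z \<and>
     (\<forall>l<r. 0 < \<sigma> l) \<and>
     (\<forall>n<N. \<forall>m<L. D $$ (n, m) = (\<Sum>l<r. \<sigma> l * Y $$ (n, l) * Z $$ (m, l)))"

end

theory Submission
  imports Defs "Jordan_Normal_Form.Schur_Decomposition"
begin

text \<open>
  The expansions use nothing about the matrices \<open>U k\<close> except that they are orthogonal: summing a
  product of one-mode factors over all multi-indices gives the product of the one-mode sums, so
  \<open>U\<^sup>T * U = 1\<close> in every mode makes the Kronecker family orthonormal and \<open>U * U\<^sup>T = 1\<close> makes it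
  complete. The existence of the \<open>U k\<close> is the real spectral theorem, proved by splitting off one
  eigenvector at a time.
\<close>

section \<open>Orthogonal diagonalization of real symmetric matrices\<close>

text \<open>The fundamental theorem of algebra gives a complex root \<open>z\<close> of the
  characteristic polynomial, with an eigenvector \<open>v\<close>. The Hermitian form of
  \<open>A\<close> at \<open>v\<close> equals \<open>z\<close> times the squared norm of
  \<open>v\<close>; as \<open>A\<close> is real symmetric, this form is its own conjugate, so
  \<open>z\<close> is real.\<close>

lemma symmetric_real_eigenvalue:
  fixes A :: "real mat"
  assumes A: "A \<in> carrier_mat n n" and sym: "A\<^sup>T = A" and "n \<noteq> 0"
  obtains e where "eigenvalue A e"
proof -
  let ?h = "complex_of_real"
  define C where "C = map_mat ?h A"
  have C: "C \<in> carrier_mat n n" using A by (simp add: C_def)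
  have "degree (char_poly C) \<noteq> 0" using degree_monic_char_poly[OF C] \<open>n \<noteq> 0\<close> by auto
  then have "\<not> constant (poly (char_poly C))" by (simp add: constant_degree)
  then obtain z where z: "poly (char_poly C) z = 0"
    using fundamental_theorem_of_algebra by blast
  then have "eigenvalue C z" using eigenvalue_root_char_poly[OF C] by simp
  then obtain v where v: "v \<in> carrier_vec n" and v0: "v \<noteq> 0\<^sub>v n"
    and ev: "C *\<^sub>v v = z \<cdot>\<^sub>v v"
    using C by (auto simp: eigenvalue_def eigenvector_def)
  have ev_i: "(\<Sum>j<n. ?h (A $$ (i, j)) * v $ j) = z * v $ i" if "i < n" for i
  proof -
    have "(C *\<^sub>v v) $ i = (\<Sum>j<n. ?h (A $$ (i, j)) * v $ j)"
      using that A v by (auto simp: C_def scalar_prod_def atLeast0LessThan intro!: sum.cong)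
    then show ?thesis using ev v that by simp
  qed
  \<comment> \<open>\<open>q\<close> is the Hermitian form of \<open>A\<close> at \<open>v\<close>,
    and \<open>p\<close> is the squared norm of \<open>v\<close>.\<close>
  define q where "q = (\<Sum>i<n. \<Sum>j<n. cnj (v $ i) * ?h (A $$ (i, j)) * v $ j)"
  define p where "p = (\<Sum>i<n. (cmod (v $ i))\<^sup>2)"
  have symm: "A $$ (j, i) = A $$ (i, j)" if "i < n" "j < n" for i j
    using that A sym by (metis carrier_matD index_transpose_mat(1))
  \<comment> \<open>Conjugation exchanges the roles of the two factors from \<open>v\<close>;
    swapping the sums and using symmetry of \<open>A\<close> restores \<open>q\<close>.\<close>
  have "cnj q = (\<Sum>i<n. \<Sum>j<n. v $ i * ?h (A $$ (i, j)) * cnj (v $ j))"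
    by (simp add: q_def)
  also have "\<dots> = (\<Sum>j<n. \<Sum>i<n. v $ i * ?h (A $$ (i, j)) * cnj (v $ j))"
    by (rule sum.swap)
  also have "\<dots> = q"
    unfolding q_def by (intro sum.cong refl) (simp add: symm mult_ac)
  finally have "cnj q = q" .
  have "q = (\<Sum>i<n. cnj (v $ i) * (z * v $ i))"
    unfolding q_def
    by (intro sum.cong refl) (simp add: ev_i[symmetric] sum_distrib_left mult.assoc)
  also have "\<dots> = z * ?h p"
    unfolding p_def of_real_sum sum_distrib_left
    by (intro sum.cong refl) (simp add: complex_norm_square mult_ac del: of_real_power)
  finally have q: "q = z * ?h p" .
  obtain i where "i < n" "v $ i \<noteq> 0" using v v0 by (metis carrier_vecD eq_vecI index_zero_vec)
  then have "p > 0" unfolding p_def by (intro sum_pos2[of _ i]) auto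
  with \<open>cnj q = q\<close> q have "cnj z = z" by simp
  then have zR: "z = ?h (Re z)" by (metis Reals_cnj_iff of_real_Re)
  \<comment> \<open>Forming the characteristic polynomial commutes with the embedding of the reals,
    so the real root \<open>z\<close> of \<open>char_poly C\<close> is a root of
    \<open>char_poly A\<close>.\<close>
  have "char_poly C = map_poly ?h (char_poly A)"
    unfolding C_def by (rule of_real_hom.char_poly_hom[OF A])
  then have "?h (poly (char_poly A) (Re z)) = 0"
    using z zR by (metis of_real_hom.poly_map_poly)
  then have "eigenvalue A (Re z)" using eigenvalue_root_char_poly[OF A] by simp
  then show ?thesis by (rule that)
qed

text \<open>A one-sided inverse of a square matrix is two-sided.\<close>

lemma is_orthogonalI:
  assumes "U \<in> carrier_mat n n" "U\<^sup>T * U = 1\<^sub>m n"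
  shows "is_orthogonal n U"
  using assms mat_mult_left_right_inverse[of "U\<^sup>T" n U] by (auto simp: is_orthogonal_def)

lemma is_orthogonal_mult:
  assumes "is_orthogonal n U" "is_orthogonal n V"
  shows "is_orthogonal n (U * V)"
proof -
  have c: "U \<in> carrier_mat n n" "V \<in> carrier_mat n n" "U\<^sup>T \<in> carrier_mat n n" "V\<^sup>T \<in> carrier_mat n n"
    using assms by (auto simp: is_orthogonal_def)
  have "(U * V)\<^sup>T * (U * V) = V\<^sup>T * (U\<^sup>T * U) * V"
    using c by (simp add: transpose_mult[of _ n n _ n] assoc_mult_mat[of _ n n _ n _ n])
  also have "\<dots> = 1\<^sub>m n" using assms c by (simp add: is_orthogonal_def)
  finally show ?thesis using c by (intro is_orthogonalI) auto
qed

text \<open>Complete \<open>v\<close> to a basis and apply Gram-Schmidt, which keeps the first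
  vector; normalising the result gives orthonormal columns. The scalar \<open>c\<close> accounts for
  normalising \<open>v\<close> itself.\<close>

lemma orthogonal_mat_extending_vec:
  fixes v :: "real vec"
  assumes v: "v \<in> carrier_vec n" and v0: "v \<noteq> 0\<^sub>v n"
  obtains W c where "is_orthogonal n W" "col W 0 = c \<cdot>\<^sub>v v"
proof -
  interpret cof_vec_space n "TYPE(real)" .
  define ws where "ws = gram_schmidt n (basis_completion v)"
  note b = basis_completion[OF v v0]
  from gram_schmidt_result[OF b(2,4,5) ws_def]
  have orth: "corthogonal ws" and ws: "set ws \<subseteq> carrier_vec n" and len: "length ws = n"
    using b(6) by auto
  have n: "0 < n" using v v0 by (cases n) auto
  have "basis_completion v = v # tl (basis_completion v)"
    using b(6,7) n by (cases "basis_completion v") auto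
  then have hd: "ws ! 0 = v"
    using gram_schmidt_hd[OF v] len n unfolding ws_def by (metis hd_conv_nth list.size(3) less_irrefl)
  have wsc: "ws ! i \<in> carrier_vec n" if "i < n" for i using ws len that by auto
  \<comment> \<open>Conjugation is trivial over the reals. The case \<open>i = j\<close> of the
    equivalence says that no vector has norm zero, so the normalising factors below make
    sense.\<close>
  have ip: "(ws ! i \<bullet> ws ! j = 0) = (i \<noteq> j)" if "i < n" "j < n" for i j
    using corthogonalD[OF orth, of i j] that len by simp
  define c where "c i = 1 / sqrt (ws ! i \<bullet> ws ! i)" for i
  define W where "W = mat_of_cols n (map (\<lambda>i. c i \<cdot>\<^sub>v ws ! i) [0..<n])"
  have W: "W \<in> carrier_mat n n" by (auto simp: W_def)
  have col: "col W i = c i \<cdot>\<^sub>v ws ! i" if "i < n" for i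
    unfolding W_def using that wsc[OF that] by (subst col_mat_of_cols) auto
  have "W\<^sup>T * W = 1\<^sub>m n"
  proof (rule eq_matI)
    fix i j assume "i < dim_row (1\<^sub>m n :: real mat)" "j < dim_col (1\<^sub>m n :: real mat)"
    then have ij: "i < n" "j < n" by auto
    have "(W\<^sup>T * W) $$ (i, j) = c i * c j * (ws ! i \<bullet> ws ! j)"
      using ij W wsc[of i] wsc[of j] by (simp add: col)
    also have "\<dots> = 1\<^sub>m n $$ (i, j)"
    proof (cases "i = j")
      case True
      have "ws ! i \<bullet> ws ! i \<ge> 0" by (auto simp: scalar_prod_def intro!: sum_nonneg)
      moreover have "ws ! i \<bullet> ws ! i \<noteq> 0" using ip[of i i] ij by simp
      ultimately show ?thesis using True ij by (simp add: c_def)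
    qed (use ij ip in auto)
    finally show "(W\<^sup>T * W) $$ (i, j) = 1\<^sub>m n $$ (i, j)" .
  qed (use W in auto)
  then have "is_orthogonal n W" by (rule is_orthogonalI[OF W])
  then show ?thesis using that col[OF n] hd by simp
qed

text \<open>Deflation by induction on the size: in an orthonormal basis that starts with an
  eigenvector, \<open>A\<close> becomes block diagonal with a block of size 1 and a smaller
  symmetric block, to which the induction hypothesis applies.\<close>

theorem symmetric_eigen_decomp_exists:
  fixes A :: "real mat"
  assumes "A \<in> carrier_mat n n" "A\<^sup>T = A"
  shows "\<exists>U S. is_eigen_decomp n A U S"
  using assms
proof (induction n arbitrary: A)
  case 0
  then show ?case
    by (intro exI[of _ "1\<^sub>m 0"]) (auto simp: is_eigen_decomp_def is_orthogonal_def diagonal_mat_def)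
next
  case (Suc n)
  let ?m = "Suc n"
  note A = Suc.prems(1) and sym = Suc.prems(2)
  obtain e where "eigenvalue A e" using symmetric_real_eigenvalue[OF A sym] by blast
  then obtain v where v: "v \<in> carrier_vec ?m" "v \<noteq> 0\<^sub>v ?m" and ev: "A *\<^sub>v v = e \<cdot>\<^sub>v v"
    using A by (auto simp: eigenvalue_def eigenvector_def)
  from orthogonal_mat_extending_vec[OF v] obtain W c
    where oW: "is_orthogonal ?m W" and W0: "col W 0 = c \<cdot>\<^sub>v v" by blast
  have W: "W \<in> carrier_mat ?m ?m" "W\<^sup>T \<in> carrier_mat ?m ?m"
    and WtW: "W\<^sup>T * W = 1\<^sub>m ?m" and WWt: "W * W\<^sup>T = 1\<^sub>m ?m"
    using oW by (auto simp: is_orthogonal_def)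
  have AW0: "A *\<^sub>v col W 0 = e \<cdot>\<^sub>v col W 0"
    using A v ev by (simp add: W0 mult_mat_vec smult_smult_assoc mult.commute)
  \<comment> \<open>\<open>B\<close> is \<open>A\<close> written in the orthonormal basis of the
    columns of \<open>W\<close>.\<close>
  define B where "B = W\<^sup>T * (A * W)"
  have B: "B \<in> carrier_mat ?m ?m" using A W by (auto simp: B_def)
  have "B\<^sup>T = (A * W)\<^sup>T * W\<^sup>T\<^sup>T"
    unfolding B_def by (rule transpose_mult) (use A W in auto)
  also have "\<dots> = B"
    using A W sym by (simp add: B_def transpose_mult[of _ ?m ?m _ ?m] assoc_mult_mat[of _ ?m ?m _ ?m _ ?m])
  finally have Bsym: "B\<^sup>T = B" .
  then have Bs: "B $$ (i, j) = B $$ (j, i)" if "i < ?m" "j < ?m" for i j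
    using B that by (metis carrier_matD index_transpose_mat(1))
  \<comment> \<open>Since column 0 of \<open>W\<close> is an eigenvector, column 0 of
    \<open>B\<close> is \<open>e\<close> times column 0 of \<open>W\<^sup>T * W\<close>, the
    identity.\<close>
  have B0: "B $$ (i, 0) = (if i = 0 then e else 0)" if i: "i < ?m" for i
  proof -
    have "B $$ (i, 0) = col W i \<bullet> (A *\<^sub>v col W 0)"
      unfolding B_def using A W i by (simp add: col_mult2[of _ ?m ?m _ ?m] mult_mat_vec_def)
    also have "\<dots> = e * (W\<^sup>T * W) $$ (i, 0)" using W i by (simp add: AW0)
    finally show ?thesis using i by (simp add: WtW)
  qed
  define C where "C = mat n n (\<lambda>(i, j). B $$ (Suc i, Suc j))"
  have C: "C \<in> carrier_mat n n" by (simp add: C_def)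
  have "C\<^sup>T = C" by (rule eq_matI) (auto simp: C_def Bs)
  from Suc.IH[OF C this] obtain V S
    where V: "V \<in> carrier_mat n n" and VtV: "V\<^sup>T * V = 1\<^sub>m n"
      and S: "S \<in> carrier_mat n n" "diagonal_mat S" and CV: "C * V = V * S"
    by (auto simp: is_eigen_decomp_def is_orthogonal_def)
  let ?blk = "\<lambda>a. four_block_mat a (0\<^sub>m 1 n) (0\<^sub>m n 1)"
  let ?e = "e \<cdot>\<^sub>m 1\<^sub>m 1"
  have Bblk: "B = ?blk ?e C"
  proof (rule eq_matI)
    fix i j assume "i < dim_row (?blk ?e C)" "j < dim_col (?blk ?e C)"
    then have ij: "i < ?m" "j < ?m" using C by auto
    show "B $$ (i, j) = ?blk ?e C $$ (i, j)"
    \<comment> \<open>Symmetry of \<open>B\<close> transfers the zeros of column 0 to row 0.\<close>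
    proof (cases "i = 0 \<or> j = 0")
      case True
      then show ?thesis using ij C B0[of i] B0[of j] Bs[of i j] by auto
    next
      case False
      then show ?thesis using ij C by (auto simp: C_def)
    qed
  qed (use B C in auto)
  \<comment> \<open>The first block is already diagonal, so the decomposition of \<open>C\<close> is
    extended by 1 in the orthogonal factor and by \<open>e\<close> in the diagonal one.\<close>
  let ?V = "?blk (1\<^sub>m 1) V" and ?S = "?blk ?e S"
  have Vc: "?V \<in> carrier_mat ?m ?m" and Sc: "?S \<in> carrier_mat ?m ?m"
    using four_block_carrier_mat[of "1\<^sub>m 1" 1 1 V n n] four_block_carrier_mat[of ?e 1 1 S n n] V S
    by auto
  have "?V\<^sup>T * ?V = ?blk (1\<^sub>m 1) (V\<^sup>T * V)"
    using V by (subst transpose_four_block_mat[of _ 1 1 _ n _ n])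
      (auto simp: mult_four_block_mat[of _ 1 1 _ n _ n _ _ 1 _ n])
  then have oV: "is_orthogonal ?m ?V" using Vc by (intro is_orthogonalI) (auto simp: VtV)
  have "B * ?V = ?blk ?e (C * V)"
    unfolding Bblk using V C by (subst mult_four_block_mat[of _ 1 1 _ n _ n _ _ 1 _ n]) auto
  also have "\<dots> = ?V * ?S"
    unfolding CV using V S by (subst mult_four_block_mat[of _ 1 1 _ n _ n _ _ 1 _ n]) auto
  finally have BV: "B * ?V = ?V * ?S" .
  \<comment> \<open>Back to the original basis: \<open>A * W = W * B\<close> and
    \<open>B * ?V = ?V * ?S\<close> make \<open>W * ?V\<close> the required orthogonal
    matrix.\<close>
  have "W * B = (W * W\<^sup>T) * (A * W)"
    unfolding B_def using A W by (intro assoc_mult_mat[symmetric]) auto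
  then have WB: "A * W = W * B" using A W by (simp add: WWt)
  have "A * (W * ?V) = A * W * ?V" using A W Vc by (intro assoc_mult_mat[symmetric]) auto
  also have "\<dots> = W * (B * ?V)" unfolding WB using B W Vc by (intro assoc_mult_mat) auto
  also have "\<dots> = W * ?V * ?S" unfolding BV using W Vc Sc by (intro assoc_mult_mat[symmetric]) auto
  finally have "A * (W * ?V) = W * ?V * ?S" .
  moreover have "diagonal_mat ?S" using S by (auto simp: diagonal_mat_def)
  ultimately show ?case
    using is_orthogonal_mult[OF oW oV] Sc unfolding is_eigen_decomp_def by blast
qed

lemma mode_gram_symmetric: "(mode_gram d I N X k)\<^sup>T = mode_gram d I N X k"
  by (rule eq_matI) (auto simp: mode_gram_def mult.commute)

section \<open>Orthonormal families of tensors\<close>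

lemma sum_tensor_apply: "(\<Sum>x\<in>A. f x :: tensor) i = (\<Sum>x\<in>A. f x i)"
  by (induction A rule: infinite_finite_induct) auto

text \<open>Pairing a vanishing linear combination with \<open>B m\<close> isolates the coefficient
  of \<open>B m\<close>, which gives independence. The expansion gives spanning; outside the index
  box both of its sides vanish.\<close>

lemma is_orthonormal_basisI:
  assumes B: "\<And>m. m < L \<Longrightarrow> B m \<in> tensor_space d I"
    and orth: "\<And>m m'. m < L \<Longrightarrow> m' < L \<Longrightarrow>
      tensor_inner d I (B m) (B m') = (if m = m' then 1 else 0)"
    and expansion: "\<And>T i. T \<in> tensor_space d I \<Longrightarrow> i \<in> multi_indices d I \<Longrightarrow>
      T i = (\<Sum>m<L. B m i * tensor_inner d I T (B m))"
  shows "is_orthonormal_basis d I L B"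
proof -
  \<comment> \<open>Two equal members with different indices would have inner product both 0 and 1.
    Injectivity turns sums over the image into sums over indices.\<close>
  have inj: "inj_on B {..<L}"
    by (rule inj_onI) (metis lessThan_iff orth zero_neq_one)
  have "tensor.independent (B ` {..<L})"
  proof (rule tensor.independent_if_scalars_zero)
    fix f x assume z: "(\<Sum>x\<in>B ` {..<L}. tensor_scale (f x) x) = 0" and "x \<in> B ` {..<L}"
    then obtain m where m: "m < L" "x = B m" by auto
    have "0 = tensor_inner d I (\<Sum>l<L. tensor_scale (f (B l)) (B l)) (B m)"
      using z by (simp add: sum.reindex[OF inj] tensor_inner_def)
    also have "\<dots> = (\<Sum>i\<in>multi_indices d I. \<Sum>l<L. f (B l) * (B l i * B m i))"
      by (simp add: tensor_inner_def sum_tensor_apply tensor_scale_def sum_distrib_right mult.assoc)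
    also have "\<dots> = (\<Sum>l<L. f (B l) * tensor_inner d I (B l) (B m))"
      by (subst sum.swap) (simp add: tensor_inner_def sum_distrib_left)
    also have "\<dots> = (\<Sum>l<L. if l = m then f (B l) else 0)"
      by (intro sum.cong refl) (use m in \<open>auto simp: orth\<close>)
    also have "\<dots> = f x" using m by simp
    finally show "f x = 0" by simp
  qed simp
  moreover have "tensor.span (B ` {..<L}) = tensor_space d I"
  proof
    show "tensor.span (B ` {..<L}) \<subseteq> tensor_space d I"
      by (rule tensor.span_minimal[OF _ subspace_tensor_space]) (use B in auto)
    show "tensor_space d I \<subseteq> tensor.span (B ` {..<L})"
    proof
      fix T assume T: "T \<in> tensor_space d I"
      have "T = (\<Sum>m<L. tensor_scale (tensor_inner d I T (B m)) (B m))"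
      proof
        fix i
        show "T i = (\<Sum>m<L. tensor_scale (tensor_inner d I T (B m)) (B m)) i"
        proof (cases "i \<in> multi_indices d I")
          case True
          then show ?thesis
            using expansion[OF T] by (simp add: sum_tensor_apply tensor_scale_def mult.commute)
        next
          case False
          then show ?thesis
            using T B by (simp add: sum_tensor_apply tensor_scale_def tensor_space_def)
        qed
      qed
      also have "\<dots> \<in> tensor.span (B ` {..<L})"
        by (intro tensor.span_sum tensor.span_scale tensor.span_base) auto
      finally show "T \<in> tensor.span (B ` {..<L})" .
    qed
  qed
  ultimately show ?thesis using B orth by (auto simp: is_orthonormal_basis_def)
qed

section \<open>Multi-indices and sums over the index box\<close>

lemma finite_multi_indices: "finite (multi_indices d I)"
  by (auto simp: multi_indices_def intro!: finite_PiE)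

lemma multi_index_less: "i \<in> multi_indices d I \<Longrightarrow> k < d \<Longrightarrow> i k < I k"
  by (auto simp: multi_indices_def PiE_iff)

lemma multi_index_eqI:
  "i \<in> multi_indices d I \<Longrightarrow> j \<in> multi_indices d I \<Longrightarrow> (\<And>k. k < d \<Longrightarrow> i k = j k) \<Longrightarrow> i = j"
  unfolding multi_indices_def by (rule PiE_ext) auto

lemma bij_betw_multi_index_of:
  "bij_betw (multi_index_of d I) {..<\<Prod>k<d. I k} (multi_indices d I)"
  unfolding multi_index_of_def by (rule bij_betw_the_inv_into[OF bij_betw_lin_index])

lemma multi_index_of_in: "m < (\<Prod>k<d. I k) \<Longrightarrow> multi_index_of d I m \<in> multi_indices d I"
  using bij_betwE[OF bij_betw_multi_index_of] by auto

text \<open>Distributivity: multiplying out the right-hand side chooses one index in each mode, that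
  is, a multi-index.\<close>

lemma sum_prod_multi_indices:
  fixes f :: "nat \<Rightarrow> nat \<Rightarrow> 'a :: comm_semiring_1"
  shows "(\<Sum>i\<in>multi_indices d I. \<Prod>k<d. f k (i k)) = (\<Prod>k<d. \<Sum>a<I k. f k a)"
  unfolding multi_indices_def by (rule prod_sum_PiE[symmetric]) auto

text \<open>A single mode in which \<open>i\<close> and \<open>j\<close> differ makes the product
  vanish; such a mode exists for distinct multi-indices because they are extensional.\<close>

lemma prod_delta_multi_indices:
  assumes "i \<in> multi_indices d I" "j \<in> multi_indices d I"
  shows "(\<Prod>k<d. if i k = j k then 1 else 0 :: 'a :: comm_semiring_1) = (if i = j then 1 else 0)"
proof (cases "i = j")
  case False
  with assms obtain k where "k < d" "i k \<noteq> j k" using multi_index_eqI by blast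
  then have "(\<Prod>k<d. if i k = j k then 1 else 0 :: 'a) = 0"
    by (intro prod_zero) auto
  with False show ?thesis by simp
qed simp

lemma is_orthogonal_cols:
  assumes "is_orthogonal n U" "a < n" "b < n"
  shows "(\<Sum>i<n. U $$ (i, a) * U $$ (i, b)) = (if a = b then 1 else 0)"
proof -
  have "U \<in> carrier_mat n n" using assms by (simp add: is_orthogonal_def)
  then have "(U\<^sup>T * U) $$ (a, b) = (\<Sum>i<n. U $$ (i, a) * U $$ (i, b))"
    using assms(2,3) by (simp add: scalar_prod_def atLeast0LessThan)
  moreover have "(U\<^sup>T * U) $$ (a, b) = (if a = b then 1 else 0)"
    using assms by (simp add: is_orthogonal_def)
  ultimately show ?thesis by simp
qed

lemma is_orthogonal_transpose: "is_orthogonal n U \<Longrightarrow> is_orthogonal n U\<^sup>T"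
  by (auto simp: is_orthogonal_def)

lemma is_orthogonal_rows:
  assumes "is_orthogonal n U" "a < n" "b < n"
  shows "(\<Sum>j<n. U $$ (a, j) * U $$ (b, j)) = (if a = b then 1 else 0)"
  using is_orthogonal_cols[OF is_orthogonal_transpose[OF assms(1)] assms(2,3)] assms
  by (auto simp: is_orthogonal_def)

section \<open>The Kronecker basis of orthogonal mode matrices\<close>

context
  fixes d :: nat and I :: "nat \<Rightarrow> nat" and U :: "nat \<Rightarrow> real mat"
  assumes orth: "\<And>k. k < d \<Longrightarrow> is_orthogonal (I k) (U k)"
begin

lemma basis_tensor_orthonormal:
  assumes j: "j \<in> multi_indices d I" and j': "j' \<in> multi_indices d I"
  shows "tensor_inner d I (basis_tensor d I U j) (basis_tensor d I U j') = (if j = j' then 1 else 0)"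
proof -
  have "tensor_inner d I (basis_tensor d I U j) (basis_tensor d I U j')
      = (\<Sum>i\<in>multi_indices d I. \<Prod>k<d. U k $$ (i k, j k) * U k $$ (i k, j' k))"
    by (simp add: tensor_inner_def basis_tensor_def prod.distrib)
  also have "\<dots> = (\<Prod>k<d. \<Sum>a<I k. U k $$ (a, j k) * U k $$ (a, j' k))"
    by (rule sum_prod_multi_indices)
  also have "\<dots> = (\<Prod>k<d. if j k = j' k then 1 else 0)"
    using orth j j' by (intro prod.cong refl is_orthogonal_cols) (auto intro: multi_index_less)
  finally show ?thesis using j j' by (simp add: prod_delta_multi_indices)
qed

text \<open>Dual to orthonormality: for the Kronecker matrix with rows \<open>i\<close> and columns
  \<open>j\<close>, this is orthonormality of the rows, and it factors over the modes in the same
  way.\<close>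

lemma basis_tensor_complete:
  assumes i: "i \<in> multi_indices d I" and i': "i' \<in> multi_indices d I"
  shows "(\<Sum>j\<in>multi_indices d I. basis_tensor d I U j i * basis_tensor d I U j i')
    = (if i = i' then 1 else 0)"
proof -
  have "(\<Sum>j\<in>multi_indices d I. basis_tensor d I U j i * basis_tensor d I U j i')
      = (\<Sum>j\<in>multi_indices d I. \<Prod>k<d. U k $$ (i k, j k) * U k $$ (i' k, j k))"
    using i i' by (simp add: basis_tensor_def prod.distrib)
  also have "\<dots> = (\<Prod>k<d. \<Sum>a<I k. U k $$ (i k, a) * U k $$ (i' k, a))"
    by (rule sum_prod_multi_indices)
  also have "\<dots> = (\<Prod>k<d. if i k = i' k then 1 else 0)"
    using orth i i' by (intro prod.cong refl is_orthogonal_rows) (auto intro: multi_index_less)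
  finally show ?thesis using i i' by (simp add: prod_delta_multi_indices)
qed

text \<open>Exchanging the two sums leaves the completeness relation as a kernel, which picks out
  the entry at \<open>i\<close>. Spanning thus needs no dimension count.\<close>

lemma basis_tensor_expansion:
  assumes i: "i \<in> multi_indices d I"
  shows "T i = (\<Sum>j\<in>multi_indices d I.
    basis_tensor d I U j i * tensor_inner d I T (basis_tensor d I U j))"
proof -
  let ?M = "multi_indices d I" and ?B = "basis_tensor d I U"
  have "(\<Sum>j\<in>?M. ?B j i * tensor_inner d I T (?B j)) = (\<Sum>j\<in>?M. \<Sum>i'\<in>?M. T i' * (?B j i * ?B j i'))"
    by (simp add: tensor_inner_def sum_distrib_left mult_ac)
  also have "\<dots> = (\<Sum>i'\<in>?M. T i' * (\<Sum>j\<in>?M. ?B j i * ?B j i'))"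
    by (subst sum.swap) (simp add: sum_distrib_left)
  also have "\<dots> = (\<Sum>i'\<in>?M. if i = i' then T i' else 0)"
    using i by (intro sum.cong refl) (auto simp: basis_tensor_complete)
  also have "\<dots> = T i" using i finite_multi_indices by simp
  finally show ?thesis by simp
qed

text \<open>The outer factors are the columns \<open>j k\<close> of \<open>U k\<close>; the product
  is nonzero because its inner product with itself is 1.\<close>

lemma basis_tensor_rank1:
  assumes j: "j \<in> multi_indices d I"
  shows "is_rank1 d I (basis_tensor d I U j)"
proof -
  have "basis_tensor d I U j \<noteq> 0"
    using basis_tensor_orthonormal[OF j j] by (auto simp: tensor_inner_def)
  moreover have "\<forall>k<d. col (U k) (j k) \<in> carrier_vec (I k)"
    using orth by (metis is_orthogonal_def carrier_matD(1) carrier_vecI dim_col)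
  moreover have "basis_tensor d I U j i = (\<Prod>k<d. col (U k) (j k) $ i k)"
    if i: "i \<in> multi_indices d I" for i
  proof -
    have "U k $$ (i k, j k) = col (U k) (j k) $ i k" if "k < d" for k
      using orth[OF that] multi_index_less[OF i that] multi_index_less[OF j that]
      by (auto simp: is_orthogonal_def)
    then show ?thesis using i by (simp add: basis_tensor_def)
  qed
  ultimately show ?thesis
    unfolding is_rank1_def
    by (auto simp: tensor_space_def basis_tensor_def intro!: exI[of _ "\<lambda>k. col (U k) (j k)"])
qed

lemma lin_basis_tensor_rank1: "m < (\<Prod>k<d. I k) \<Longrightarrow> is_rank1 d I (lin_basis_tensor d I U m)"
  unfolding lin_basis_tensor_def by (intro basis_tensor_rank1 multi_index_of_in)

text \<open>The expansion over multi-indices, reindexed along the bijection from linear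
  indices.\<close>

lemma lin_basis_tensor_expansion:
  assumes "i \<in> multi_indices d I"
  shows "T i = (\<Sum>m<(\<Prod>k<d. I k).
    lin_basis_tensor d I U m i * tensor_inner d I T (lin_basis_tensor d I U m))"
  unfolding lin_basis_tensor_def
  by (subst sum.reindex_bij_betw[OF bij_betw_multi_index_of,
        of "\<lambda>j. basis_tensor d I U j i * tensor_inner d I T (basis_tensor d I U j)"])
    (rule basis_tensor_expansion[OF assms])

lemma lin_basis_tensor_orthonormal_basis:
  "is_orthonormal_basis d I (\<Prod>k<d. I k) (lin_basis_tensor d I U)"
proof (rule is_orthonormal_basisI)
  fix m m' assume m: "m < (\<Prod>k<d. I k)" "m' < (\<Prod>k<d. I k)"
  \<comment> \<open>Injectivity of the index map turns the Kronecker delta of multi-indices into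
    that of linear indices.\<close>
  then have "multi_index_of d I m = multi_index_of d I m' \<longleftrightarrow> m = m'"
    using inj_on_eq_iff[OF bij_betw_imp_inj_on[OF bij_betw_multi_index_of]] by simp
  then show "tensor_inner d I (lin_basis_tensor d I U m) (lin_basis_tensor d I U m')
      = (if m = m' then 1 else 0)"
    using m by (simp add: lin_basis_tensor_def basis_tensor_orthonormal multi_index_of_in)
next
  fix m assume "m < (\<Prod>k<d. I k)"
  then show "lin_basis_tensor d I U m \<in> tensor_space d I"
    using lin_basis_tensor_rank1 by (simp add: is_rank1_def)
qed (rule lin_basis_tensor_expansion)

end

section \<open>Eigenbases of the mode matrices and the resulting expansions\<close>

theorem mainTheorem4:
  fixes d N L :: nat and I :: "nat \<Rightarrow> nat" and X :: "nat \<Rightarrow> tensor"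
  assumes "d \<ge> 1" and "N \<ge> 1" and "\<And>k. k < d \<Longrightarrow> I k \<ge> 1"
    and "L = (\<Prod>k<d. I k)"
    and "\<And>n. n < N \<Longrightarrow> X n \<in> tensor_space d I"
  shows
    "(\<forall>k<d. (mode_gram d I N X k)\<^sup>T = mode_gram d I N X k \<and>
            (\<exists>U S. is_eigen_decomp (I k) (mode_gram d I N X k) U S)) \<and>
     (\<forall>U S. (\<forall>k<d. is_eigen_decomp (I k) (mode_gram d I N X k) (U k) (S k)) \<longrightarrow>
        (\<forall>m<L. is_rank1 d I (lin_basis_tensor d I U m)) \<and>
        is_orthonormal_basis d I L (lin_basis_tensor d I U) \<and>
        (\<forall>n<N. \<forall>i\<in>multi_indices d I.
           X n i = (\<Sum>m<L. lin_basis_tensor d I U m i * coeff_mat d I N L X U $$ (n, m))) \<and>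
        (\<forall>r \<sigma> Y Z. is_reduced_svd N L (coeff_mat d I N L X U) r \<sigma> Y Z \<longrightarrow>
           (\<forall>n<N. \<forall>i\<in>multi_indices d I.
              X n i = (\<Sum>m<L. \<Sum>l<r.
                 lin_basis_tensor d I U m i * \<sigma> l * Y $$ (n, l) * Z $$ (m, l)))))"
proof (intro conjI allI impI ballI)
  fix k
  show "(mode_gram d I N X k)\<^sup>T = mode_gram d I N X k" by (rule mode_gram_symmetric)
  show "\<exists>U S. is_eigen_decomp (I k) (mode_gram d I N X k) U S"
    by (rule symmetric_eigen_decomp_exists[OF _ mode_gram_symmetric]) (simp add: mode_gram_def)
next
  fix U S
  assume "\<forall>k<d. is_eigen_decomp (I k) (mode_gram d I N X k) (U k) (S k)"
  then have U: "\<And>k. k < d \<Longrightarrow> is_orthogonal (I k) (U k)" by (auto simp: is_eigen_decomp_def)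
  let ?D = "coeff_mat d I N L X U"
  show "is_rank1 d I (lin_basis_tensor d I U m)" if "m < L" for m
    using lin_basis_tensor_rank1[OF U] that assms(4) by simp
  show "is_orthonormal_basis d I L (lin_basis_tensor d I U)"
    unfolding assms(4) by (rule lin_basis_tensor_orthonormal_basis[OF U])
  \<comment> \<open>Row \<open>n\<close> of \<open>?D\<close> holds, by definition, the inner
    products that occur in the expansion of \<open>X n\<close>.\<close>
  show exp: "X n i = (\<Sum>m<L. lin_basis_tensor d I U m i * ?D $$ (n, m))"
    if n: "n < N" and i: "i \<in> multi_indices d I" for n i
    using lin_basis_tensor_expansion[OF U i, of "X n"] n by (simp add: coeff_mat_def assms(4))
  fix r \<sigma> Y Z n i
  assume svd: "is_reduced_svd N L ?D r \<sigma> Y Z" and n: "n < N" and i: "i \<in> multi_indices d I"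
  \<comment> \<open>The singular value decomposition is substituted entry by entry for the
    coefficients.\<close>
  then have "X n i = (\<Sum>m<L. lin_basis_tensor d I U m i * (\<Sum>l<r. \<sigma> l * Y $$ (n, l) * Z $$ (m, l)))"
    by (simp add: exp is_reduced_svd_def)
  then show "X n i = (\<Sum>m<L. \<Sum>l<r.
      lin_basis_tensor d I U m i * \<sigma> l * Y $$ (n, l) * Z $$ (m, l))"
    by (simp add: sum_distrib_left mult.assoc)
qed

end
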